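(* Let $n\geq 1$ and $m>1$ be integers, let $(\delta_k)_{k\in\mathbb{N}}$ be a sequence of positive numbers and let $a>0$. Then there exists a $1$-Lipschitz map $v\colon\mathbb{R}^n\to\mathbb{R}^m$ such that for every $k\in\mathbb{N}$ there exist sets $A_k\subset B_k\subset\mathbb{R}^n$ and a $1$-Lipschitz map $u_k\colon A_k\to\mathbb{R}^m$ such that $$\sup\big\{\lVert v(x)-u_k(x)\rVert\mid x\in A_k\big\}=\delta_k$$ and for any $1$-Lipschitz extension $\tilde{u}_k\colon B_k\to\mathbb{R}^m$ of $u_k$ to $B_k$ we have $$\sup\big\{\lVert v(x)-\tilde{u}_k(x)\rVert\mid x\in B_k\big\}=\sqrt{\delta_k^2+2\delta_k a}.$$
   Context: Euclidean spaces carry the Euclidean norm; a map $f$ on a set $S\subset\mathbb{R}^n$ is $1$-Lipschitz if $\lVert f(x)-f(y)\rVert\leq\lVert x-y\rVert$ for all $x,y\in S$. An extension of $u_k$ to $B_k$ is a map on $B_k$ that agrees with $u_k$ on $A_k$. *)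

theory Defs
  imports "HOL-Analysis.Analysis"
begin

end

theory Submission
  imports Defs
begin

text \<open>
  Let \<open>h\<^sub>k = sqrt (\<delta>\<^sub>k\<^sup>2 + 2 \<delta>\<^sub>k a)\<close>, so that \<open>a\<^sup>2 + h\<^sub>k\<^sup>2 = (\<delta>\<^sub>k + a)\<^sup>2\<close>. The map \<open>v\<close> depends on one
  coordinate only and is a unit-speed polygonal path that runs back and forth between
  \<open>-a e\<^sub>1\<close> and \<open>a e\<^sub>1\<close>, passing on its \<open>k\<close>-th trip through \<open>h\<^sub>k e\<^sub>2\<close>; both legs of that trip have
  length \<open>\<delta>\<^sub>k + a\<close>. Let \<open>A\<^sub>k\<close> consist of the two end points of the \<open>k\<close>-th parameter interval and let
  \<open>B\<^sub>k\<close> contain its midpoint as well. The map \<open>u\<^sub>k\<close> moves the end values outwards by \<open>\<delta>\<^sub>k\<close>, which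
  makes it isometric on \<open>A\<^sub>k\<close>. Hence every 1-Lipschitz extension sends the midpoint to \<open>0\<close>, at
  distance \<open>h\<^sub>k\<close> from \<open>v\<close>.
\<close>

text \<open>Interpolate linearly between the points \<open>Q j\<close> at the times
  \<open>T j\<close>. No piece exceeds unit speed, and the overlaps of an interval from
  \<open>s\<close> to \<open>t\<close> with the pieces have total length at most
  \<open>t - s\<close>.\<close>

lemma lipschitz_polygonal_path:
  fixes Q :: "nat \<Rightarrow> 'a::real_normed_vector" and T :: "nat \<Rightarrow> real"
  assumes mono: "strict_mono T"
    and unbounded: "\<And>t. \<exists>n. t \<le> T n"
    and step: "\<And>j. norm (Q (Suc j) - Q j) \<le> T (Suc j) - T j"
  shows "\<exists>\<gamma>. 1-lipschitz_on UNIV \<gamma> \<and> (\<forall>j. \<gamma> (T j) = Q j)"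
proof -
  \<comment> \<open>\<open>inc j t\<close> is the part of the \<open>j\<close>-th time interval
    elapsed at time \<open>t\<close>. Writing the path as a sum of increments avoids locating the
    interval that contains \<open>t\<close>, and the increments telescope.\<close>
  define inc where "inc j t = min t (T (Suc j)) - min t (T j)" for j t
  define g where "g N t = Q 0 + (\<Sum>j<N. (inc j t / (T (Suc j) - T j)) *\<^sub>R (Q (Suc j) - Q j))" for N t
  have less: "T j < T (Suc j)" for j
    using mono by (simp add: strict_mono_Suc_iff)
  have le: "T i \<le> T j" if "i \<le> j" for i j
    using mono that by (simp add: strict_mono_less_eq)
  have lip: "norm (g N t - g N s) \<le> t - s" if "s \<le> t" for N s t
  proof -
    have "g N t - g N s
        = (\<Sum>j<N. ((inc j t - inc j s) / (T (Suc j) - T j)) *\<^sub>R (Q (Suc j) - Q j))"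
      by (simp add: g_def sum_subtractf [symmetric] scaleR_left_diff_distrib diff_divide_distrib)
    also have "norm \<dots> \<le> (\<Sum>j<N. inc j t - inc j s)"
    proof (rule sum_norm_le)
      fix j
      have nonneg: "0 \<le> inc j t - inc j s"
        using less [of j] that by (auto simp: inc_def min_def)
      have "norm (((inc j t - inc j s) / (T (Suc j) - T j)) *\<^sub>R (Q (Suc j) - Q j))
          = (inc j t - inc j s) / (T (Suc j) - T j) * norm (Q (Suc j) - Q j)"
        using nonneg less [of j] by simp
      also have "\<dots> \<le> (inc j t - inc j s) / (T (Suc j) - T j) * (T (Suc j) - T j)"
        using nonneg less [of j] step [of j] by (intro mult_left_mono) auto
      also have "\<dots> = inc j t - inc j s"
        using less [of j] by simp
      finally show "norm (((inc j t - inc j s) / (T (Suc j) - T j)) *\<^sub>R (Q (Suc j) - Q j))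
          \<le> inc j t - inc j s" .
    qed
    also have "\<dots> = (min t (T N) - min t (T 0)) - (min s (T N) - min s (T 0))"
      using sum_lessThan_telescope [of "\<lambda>r. min t (T r)" N]
        sum_lessThan_telescope [of "\<lambda>r. min s (T r)" N]
      by (simp only: inc_def sum_subtractf [of "\<lambda>j. min _ (T (Suc j)) - min _ (T j)"])
    also have "\<dots> \<le> t - s"
      using that le [of 0 N] by (auto simp: min_def)
    finally show ?thesis .
  qed
  \<comment> \<open>Increments over intervals starting at or after \<open>t\<close> vanish. Hence
    \<open>\<gamma>\<close>, which cuts the sum off at an index depending on \<open>t\<close>,
    agrees with the single map \<open>g N\<close> up to time \<open>T N\<close>.\<close>
  have stable: "g M t = g N t" if "t \<le> T N" "N \<le> M" for M N t
    unfolding g_def using that le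
    by (intro arg_cong2 [where f = "(+)"] refl sum.mono_neutral_right)
       (auto simp: inc_def min_def intro: order_trans dest: le)
  obtain n where n: "\<And>t. t \<le> T (n t)"
    using unbounded by metis
  define \<gamma> where "\<gamma> t = g (n t) t" for t
  have \<gamma>: "\<gamma> t = g N t" if "t \<le> T N" for t N
    using stable [OF that, of "max N (n t)"] stable [OF n, of t "max N (n t)"]
    by (simp add: \<gamma>_def)
  have dist: "dist (\<gamma> s) (\<gamma> t) \<le> t - s" if "s \<le> t" for s t
    using \<gamma> [of s "n t"] \<gamma> [of t "n t"] n [of t] that lip [OF that, of "n t"]
    by (simp add: dist_norm norm_minus_commute)
  have "dist (\<gamma> s) (\<gamma> t) \<le> 1 * dist s t" for s t
    using dist [of s t] dist [of t s] by (cases "s \<le> t") (auto simp: dist_real_def dist_commute)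
  then have "1-lipschitz_on UNIV \<gamma>"
    by (auto intro: lipschitz_onI)
  moreover have "\<gamma> (T j) = Q j" for j
  proof -
    have "(\<Sum>i<j. (inc i (T j) / (T (Suc i) - T i)) *\<^sub>R (Q (Suc i) - Q i))
        = (\<Sum>i<j. Q (Suc i) - Q i)"
    proof (rule sum.cong [OF refl])
      fix i assume "i \<in> {..<j}"
      then have "inc i (T j) = T (Suc i) - T i"
        using le [of i j] le [of "Suc i" j] by (simp add: inc_def)
      then show "(inc i (T j) / (T (Suc i) - T i)) *\<^sub>R (Q (Suc i) - Q i) = Q (Suc i) - Q i"
        using less [of i] by simp
    qed
    then show ?thesis
      using \<gamma> [of "T j" j] by (simp add: g_def sum_lessThan_telescope)
  qed
  ultimately show ?thesis
    by blast
qed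

text \<open>Adding the squared inequalities cancels the mixed terms and leaves
  \<open>x \<bullet> x \<le> 0\<close>. Geometrically, two balls of radius \<open>norm y\<close>
  about \<open>y\<close> and \<open>- y\<close> touch only at the origin.\<close>

lemma eq_0_if_close_to_antipodes:
  fixes x y :: "'a::real_inner"
  assumes "norm (x - y) \<le> norm y" "norm (x + y) \<le> norm y"
  shows "x = 0"
proof -
  have "(norm (x - y))\<^sup>2 \<le> (norm y)\<^sup>2" "(norm (x + y))\<^sup>2 \<le> (norm y)\<^sup>2"
    using assms by (simp_all add: power_mono)
  then have "x \<bullet> x \<le> 0"
    by (simp add: power2_norm_eq_inner inner_diff_left inner_diff_right inner_add_left
        inner_add_right inner_commute)
  then show ?thesis
    using inner_ge_zero [of x] by simp
qed

theorem proposition2p4: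
  fixes \<delta> :: "nat \<Rightarrow> real" and a :: real
  assumes "CARD('m::finite) > 1"
    and "\<And>k. \<delta> k > 0"
    and "a > 0"
  shows "\<exists>v :: real ^ 'n::finite \<Rightarrow> real ^ 'm.
    1-lipschitz_on UNIV v \<and>
    (\<forall>k. \<exists>(A :: (real ^ 'n) set) (B :: (real ^ 'n) set) (u :: real ^ 'n \<Rightarrow> real ^ 'm).
      A \<subseteq> B \<and> 1-lipschitz_on A u \<and>
      (SUP x\<in>A. ereal (norm (v x - u x))) = ereal (\<delta> k) \<and>
      (\<forall>u' :: real ^ 'n \<Rightarrow> real ^ 'm.
        1-lipschitz_on B u' \<and> (\<forall>x\<in>A. u' x = u x) \<longrightarrow>
        (SUP x\<in>B. ereal (norm (v x - u' x))) = ereal (sqrt ((\<delta> k)\<^sup>2 + 2 * \<delta> k * a))))"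
proof -
  obtain i j :: 'm where "i \<noteq> j"
    using assms(1) by (metis card_2_iff' card_le_Suc0_iff_eq finite One_nat_def UNIV_I not_less)
  define e1 e2 :: "real ^ 'm" where "e1 = axis i 1" and "e2 = axis j 1"
  have inner_e: "e1 \<bullet> e1 = 1" "e2 \<bullet> e2 = 1" "e1 \<bullet> e2 = 0" "e2 \<bullet> e1 = 0"
    using \<open>i \<noteq> j\<close> by (simp_all add: e1_def e2_def inner_axis_axis)
  have norm_e: "norm e1 = 1" "norm e2 = 1"
    by (simp_all add: e1_def e2_def)
  define h where "h k = sqrt ((\<delta> k)\<^sup>2 + 2 * \<delta> k * a)" for k
  \<comment> \<open>\<open>\<sigma> k\<close> is the sign of the end point at which trip
    \<open>k\<close> starts.\<close>
  define \<sigma> :: "nat \<Rightarrow> real" where "\<sigma> k = (- 1) ^ k" for k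
  have h0: "0 \<le> h k" and h2: "(h k)\<^sup>2 = (\<delta> k)\<^sup>2 + 2 * \<delta> k * a" for k
    using assms(2) [of k] assms(3) by (simp_all add: h_def)
  have \<delta>_le_h: "\<delta> k \<le> h k" for k
    using assms(2) [of k] assms(3) by (auto simp: h_def intro!: real_le_rsqrt)
  have abs_\<sigma>: "\<bar>\<sigma> k\<bar> = 1" and \<sigma>2: "\<sigma> k * \<sigma> k = 1" for k
    by (simp_all add: \<sigma>_def power_abs flip: power_mult_distrib)
  \<comment> \<open>Trip \<open>k\<close> consists of the legs \<open>2 * k\<close> and
    \<open>2 * k + 1\<close>, hence \<open>r div 2\<close>. Even vertices of \<open>Q\<close> are
    end points, odd ones the turning points on the \<open>e2\<close> axis.\<close>
  define T where "T l = (\<Sum>r<l. \<delta> (r div 2) + a)" for l :: nat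
  define Q where "Q l = (if even l then (\<sigma> (l div 2) * a) *\<^sub>R e1 else h (l div 2) *\<^sub>R e2)" for l
  have T_Suc: "T (Suc l) = T l + (\<delta> (l div 2) + a)" for l
    by (simp add: T_def)
  have T_mono: "strict_mono T"
    using assms(2,3) by (simp add: strict_mono_Suc_iff T_Suc add_pos_pos)
  \<comment> \<open>Each leg lasts at least \<open>a\<close>, so the times are unbounded even if the
    \<delta>'s are summable.\<close>
  have T_ge: "real l * a \<le> T l" for l
  proof (induction l)
    case (Suc l)
    then show ?case
      using assms(2) [of "l div 2"] by (simp add: T_Suc algebra_simps)
  qed (simp add: T_def)
  have T_unbounded: "\<exists>l. t \<le> T l" for t
    using reals_Archimedean3 [OF assms(3)] T_ge by (metis order_trans less_imp_le)
  \<comment> \<open>The sign has its own index because the return leg of trip \<open>k\<close> ends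
    at sign \<open>\<sigma> (Suc k)\<close>.\<close>
  have legs: "norm (h k *\<^sub>R e2 - (\<sigma> l * a) *\<^sub>R e1) = \<delta> k + a" for k l
  proof -
    have "(norm (h k *\<^sub>R e2 - (\<sigma> l * a) *\<^sub>R e1))\<^sup>2 = (h k)\<^sup>2 + (\<sigma> l * \<sigma> l) * a\<^sup>2"
      unfolding power2_norm_eq_inner
      by (simp add: inner_diff_left inner_diff_right inner_e power2_eq_square algebra_simps)
    also have "\<dots> = (\<delta> k + a)\<^sup>2"
      unfolding h2 \<sigma>2 by (simp add: power2_eq_square algebra_simps)
    finally show ?thesis
      using assms(2) [of k] assms(3) by (simp add: power2_eq_iff_nonneg)
  qed
  have "norm (Q (Suc l) - Q l) \<le> T (Suc l) - T l" for l
  proof (cases "even l")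
    case True
    then show ?thesis
      using legs by (simp add: Q_def T_Suc)
  next
    case False
    then show ?thesis
      using legs by (simp add: Q_def T_Suc norm_minus_commute)
  qed
  from lipschitz_polygonal_path [OF T_mono T_unbounded this]
  obtain \<gamma> where \<gamma>_lip: "1-lipschitz_on UNIV \<gamma>" and \<gamma>: "\<And>l. \<gamma> (T l) = Q l"
    by blast
  obtain c :: 'n where True
    by simp
  define v :: "real ^ 'n \<Rightarrow> real ^ 'm" where "v x = \<gamma> (x $ c)" for x
  have v_lip: "1-lipschitz_on UNIV v"
  proof (rule lipschitz_onI)
    fix x y :: "real ^ 'n"
    have "dist (v x) (v y) \<le> 1 * dist (x $ c) (y $ c)"
      using lipschitz_onD [OF \<gamma>_lip] by (simp add: v_def)
    also have "\<dots> \<le> 1 * dist x y"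
      using dist_vec_nth_le by simp
    finally show "dist (v x) (v y) \<le> 1 * dist x y" .
  qed simp
  \<comment> \<open>On the axis of coordinate \<open>c\<close> the projection is isometric, so
    distances between these points are time differences.\<close>
  define P :: "nat \<Rightarrow> real ^ 'n" where "P l = axis c (T l)" for l
  have v_P: "v (P l) = Q l" for l
    by (simp add: v_def P_def \<gamma>)
  have dist_P: "dist (P l) (P l') = \<bar>T l - T l'\<bar>" for l l'
  proof -
    have "P l - P l' = (T l - T l') *\<^sub>R axis c 1"
      by (simp add: P_def vec_eq_iff axis_def)
    then show ?thesis
      by (simp add: dist_norm)
  qed
  show ?thesis
  proof (intro exI conjI allI)
    fix k
    let ?p = "P (2 * k)" and ?m = "P (Suc (2 * k))" and ?q = "P (Suc (Suc (2 * k)))"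
    \<comment> \<open>This is \<open>v ?p\<close> pushed outwards by \<open>\<delta> k\<close>; its
      norm equals the duration of a leg.\<close>
    define w where "w = (\<sigma> k * (\<delta> k + a)) *\<^sub>R e1"
    define u where "u x = (if x = ?p then w else - w)" for x
    have pos: "0 < \<delta> k" "0 < \<delta> k + a"
      using assms(2) [of k] assms(3) by simp_all
    have norm_w: "norm w = \<delta> k + a"
      using pos by (simp add: w_def abs_mult abs_\<sigma> norm_e)
    have dists: "dist ?m ?p = \<delta> k + a" "dist ?m ?q = \<delta> k + a" "dist ?p ?q = 2 * (\<delta> k + a)"
      using pos by (simp_all add: dist_P T_Suc)
    then have "?q \<noteq> ?p"
      using pos by auto
    then have u: "u ?p = w" "u ?q = - w"
      by (simp_all add: u_def)
    \<comment> \<open>The sign flips from \<open>?p\<close> to \<open>?q\<close>, so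
      \<open>- w\<close> is \<open>v ?q\<close> pushed outwards as well.\<close>
    have "v ?p - u ?p = (- (\<sigma> k * \<delta> k)) *\<^sub>R e1" "v ?q - u ?q = (\<sigma> k * \<delta> k) *\<^sub>R e1"
      unfolding u v_P by (simp_all add: Q_def w_def \<sigma>_def algebra_simps)
    then have err: "norm (v ?p - u ?p) = \<delta> k" "norm (v ?q - u ?q) = \<delta> k"
      using pos by (simp_all add: abs_mult abs_\<sigma> norm_e)
    have "dist w (- w) = 2 * (\<delta> k + a)"
      using norm_w by (simp add: dist_norm flip: scaleR_2)
    then show "1-lipschitz_on {?p, ?q} u"
      by (intro lipschitz_onI) (auto simp: u dists dist_commute)
    show "{?p, ?q} \<subseteq> {?p, ?m, ?q}"
      by blast
    show "(SUP x\<in>{?p, ?q}. ereal (norm (v x - u x))) = ereal (\<delta> k)"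
      by (simp add: err)
    fix u' :: "real ^ 'n \<Rightarrow> real ^ 'm"
    show "1-lipschitz_on {?p, ?m, ?q} u' \<and> (\<forall>x\<in>{?p, ?q}. u' x = u x) \<longrightarrow>
        (SUP x\<in>{?p, ?m, ?q}. ereal (norm (v x - u' x))) = ereal (sqrt ((\<delta> k)\<^sup>2 + 2 * \<delta> k * a))"
    proof
      assume asm: "1-lipschitz_on {?p, ?m, ?q} u' \<and> (\<forall>x\<in>{?p, ?q}. u' x = u x)"
      then have lip: "1-lipschitz_on {?p, ?m, ?q} u'" and u': "u' ?p = u ?p" "u' ?q = u ?q"
        by blast+
      have "dist (u' ?m) (u' ?p) \<le> 1 * dist ?m ?p" "dist (u' ?m) (u' ?q) \<le> 1 * dist ?m ?q"
        by (rule lipschitz_onD [OF lip]; simp)+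
      then have "norm (u' ?m - w) \<le> norm w" "norm (u' ?m + w) \<le> norm w"
        unfolding u' u dists by (simp_all add: norm_w dist_norm)
      then have "u' ?m = 0"
        by (rule eq_0_if_close_to_antipodes)
      then have "norm (v ?m - u' ?m) = h k"
        using h0 [of k] by (simp add: v_P Q_def norm_e)
      \<comment> \<open>The errors at the end points are still \<open>\<delta> k\<close>, which is
        at most \<open>h k\<close>, so the midpoint attains the supremum.\<close>
      then have "(SUP x\<in>{?p, ?m, ?q}. ereal (norm (v x - u' x))) = ereal (h k)"
        using \<delta>_le_h [of k] by (simp add: u' err sup_max max_def bot_ereal_def)
      then show "(SUP x\<in>{?p, ?m, ?q}. ereal (norm (v x - u' x)))
          = ereal (sqrt ((\<delta> k)\<^sup>2 + 2 * \<delta> k * a))"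
        by (simp add: h_def)
    qed
  qed (rule v_lip)
qed

end
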